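(* Let $\alpha,\delta_1,\delta_2>0$ and $\beta_1=1+\alpha^2+\delta_1+\delta_2$. For the system on $\mathbb T=\mathbb R/2\pi\mathbb Z$ $$\partial_t u_1=\delta_1\partial_x^2u_1-(\beta+1)u_1+u_1^2u_2+\alpha,\qquad \partial_t u_2=\delta_2\partial_x^2u_2+\beta u_1-u_1^2u_2$$ with $\beta=\beta_1$, there is no Turing instability for the uniform state $(\alpha,\beta_1/\alpha)$; i.e. the diffusion terms are not a destabilizer in the sense of Turing.
   Context: Linearizing at the uniform state $(\alpha,\beta_1/\alpha)$ gives the operator $$\mathbf L_{\beta_1}=\begin{pmatrix}\delta_1\partial_x^2+\beta_1-1&\alpha^2\\-\beta_1&\delta_2\partial_x^2-\alpha^2\end{pmatrix}$$ on $L^2(\mathbb T)^2$ with domain $H^2(\mathbb T)^2$; without diffusion the linearization is the matrix $\begin{pmatrix}\beta_1-1&\alpha^2\\-\beta_1&-\alpha^2\end{pmatrix}$. A uniform state is Turing unstable (exhibits Turing instability) if it is spectrally stable without diffusion (the linearization without the diffusion terms has no spectrum in the open right half-plane) and becomes spectrally unstable when the diffusion terms are included. *)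

theory Defs
  imports "HOL-Analysis.Analysis"
begin

section \<open>Function spaces on the torus\<close>

text \<open>
  Functions on \<open>\<real> / 2\<pi>\<int>\<close> are \<open>2\<pi>\<close>-periodic functions on \<open>\<real>\<close>. Elements of \<open>L\<^sup>2\<close> are
  represented by functions, not by classes modulo null sets, so equalities in \<open>L\<^sup>2\<close> are
  written as almost-everywhere equalities throughout. All spaces are complex, as needed for spectra.
\<close>

definition torus_periodic :: "(real \<Rightarrow> 'a) \<Rightarrow> bool" where
  "torus_periodic f \<longleftrightarrow> (\<forall>x. f (x + 2 * pi) = f x)"

definition L2_torus :: "(real \<Rightarrow> complex ^ 'n) set" where
  "L2_torus = {f. torus_periodic f \<and> f \<in> borel_measurable lebesgue \<and>
     set_integrable lebesgue {0..2*pi} (\<lambda>x. (norm (f x))\<^sup>2)}"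

definition L2_torus_norm :: "(real \<Rightarrow> complex ^ 'n) \<Rightarrow> real" where
  "L2_torus_norm f = sqrt (LINT x:{0..2*pi}|lebesgue. (norm (f x))\<^sup>2)"

definition torus_test_function :: "(real \<Rightarrow> real) \<Rightarrow> bool" where
  "torus_test_function \<phi> \<longleftrightarrow>
     torus_periodic \<phi> \<and> (\<forall>k x. (deriv ^^ k) \<phi> differentiable (at x))"

text \<open>\<open>g\<close> is a weak derivative of order \<open>k\<close> of \<open>f\<close> on the torus. Testing against all periodic
  functions, not only those supported inside a period, also rules out jumps at the endpoints.\<close>

definition weak_deriv_torus ::
  "nat \<Rightarrow> (real \<Rightarrow> complex ^ 'n) \<Rightarrow> (real \<Rightarrow> complex ^ 'n) \<Rightarrow> bool" where
  "weak_deriv_torus k f g \<longleftrightarrow> (\<forall>\<phi>. torus_test_function \<phi> \<longrightarrow>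
     (LINT x:{0..2*pi}|lebesgue. (deriv ^^ k) \<phi> x *\<^sub>R f x) =
     (-1) ^ k *\<^sub>R (LINT x:{0..2*pi}|lebesgue. \<phi> x *\<^sub>R g x))"

definition H2_torus :: "(real \<Rightarrow> complex ^ 'n) set" where
  "H2_torus = {f \<in> L2_torus. (\<exists>g\<in>L2_torus. weak_deriv_torus 1 f g) \<and>
                             (\<exists>h\<in>L2_torus. weak_deriv_torus 2 f h)}"


section \<open>Spectra\<close>

definition matrix_spectrum :: "complex ^ 'n ^ 'n \<Rightarrow> complex set" where
  "matrix_spectrum A = {z. \<not> invertible (mat z - A)}"

text \<open>
  An unbounded operator \<open>T\<close> on \<open>L\<^sup>2\<close> is given by its graph: \<open>(u, w) \<in> T\<close> means that \<open>u\<close> is in the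
  domain and \<open>w = T u\<close>. Hence \<open>(u, z u - f) \<in> T\<close> says that \<open>(z - T) u = f\<close>. The resolvent set
  consists of the \<open>z\<close> for which \<open>z - T\<close> is onto, one-to-one (modulo null sets) and has a
  bounded inverse.
\<close>

definition resolvent_set_L2 ::
  "((real \<Rightarrow> complex ^ 'n) \<times> (real \<Rightarrow> complex ^ 'n)) set \<Rightarrow> complex set" where
  "resolvent_set_L2 T = {z.
     (\<forall>f\<in>L2_torus. \<exists>u. (u, \<lambda>x. z *s u x - f x) \<in> T) \<and>
     (\<forall>f\<in>L2_torus. \<forall>u v. (u, \<lambda>x. z *s u x - f x) \<in> T \<and> (v, \<lambda>x. z *s v x - f x) \<in> T \<longrightarrow>
        (AE x in lebesgue. u x = v x)) \<and>
     (\<exists>C. \<forall>f\<in>L2_torus. \<forall>u. (u, \<lambda>x. z *s u x - f x) \<in> T \<longrightarrow>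
        L2_torus_norm u \<le> C * L2_torus_norm f)}"

definition spectrum_L2 ::
  "((real \<Rightarrow> complex ^ 'n) \<times> (real \<Rightarrow> complex ^ 'n)) set \<Rightarrow> complex set" where
  "spectrum_L2 T = - resolvent_set_L2 T"


section \<open>Reaction-diffusion systems and Turing instability\<close>

text \<open>
  The system is \<open>\<partial>\<^sub>t u = diag d \<partial>\<^sub>x\<^sup>2 u + F u\<close> with diffusion coefficients \<open>d\<close> and reaction term
  \<open>F\<close>; its linearization at a constant state \<open>U\<close> is \<open>diag d \<partial>\<^sub>x\<^sup>2 + DF(U)\<close>.
\<close>

definition kinetic_linearization ::
  "(real ^ 'n \<Rightarrow> real ^ 'n) \<Rightarrow> real ^ 'n \<Rightarrow> complex ^ 'n ^ 'n" where
  "kinetic_linearization F U = map_matrix complex_of_real (jacobian F (at U))"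

text \<open>The graph of \<open>diag d \<partial>\<^sub>x\<^sup>2 + A\<close> on \<open>L\<^sup>2\<close> with domain \<open>H\<^sup>2\<close>.\<close>

definition diffusion_operator ::
  "real ^ 'n \<Rightarrow> complex ^ 'n ^ 'n \<Rightarrow> ((real \<Rightarrow> complex ^ 'n) \<times> (real \<Rightarrow> complex ^ 'n)) set" where
  "diffusion_operator d A = {(u, w). u \<in> H2_torus \<and> w \<in> L2_torus \<and>
     (\<exists>v\<in>L2_torus. weak_deriv_torus 2 u v \<and>
        (AE x in lebesgue. w x = (\<chi> i. complex_of_real (d $ i) * v x $ i) + A *v u x))}"

definition diffusive_linearization ::
  "real ^ 'n \<Rightarrow> (real ^ 'n \<Rightarrow> real ^ 'n) \<Rightarrow> real ^ 'n \<Rightarrow>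
   ((real \<Rightarrow> complex ^ 'n) \<times> (real \<Rightarrow> complex ^ 'n)) set" where
  "diffusive_linearization d F U = diffusion_operator d (kinetic_linearization F U)"

definition spectrally_stable :: "complex set \<Rightarrow> bool" where
  "spectrally_stable \<sigma> \<longleftrightarrow> \<sigma> \<inter> {z. Re z > 0} = {}"

definition Turing_unstable ::
  "real ^ 'n \<Rightarrow> (real ^ 'n \<Rightarrow> real ^ 'n) \<Rightarrow> real ^ 'n \<Rightarrow> bool" where
  "Turing_unstable d F U \<longleftrightarrow>
     spectrally_stable (matrix_spectrum (kinetic_linearization F U)) \<and>
     \<not> spectrally_stable (spectrum_L2 (diffusive_linearization d F U))"


section \<open>The Brusselator\<close>

definition brusselator :: "real \<Rightarrow> real \<Rightarrow> real ^ 2 \<Rightarrow> real ^ 2" where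
  "brusselator \<alpha> \<beta> u =
     vector [- (\<beta> + 1) * u $ 1 + (u $ 1)\<^sup>2 * u $ 2 + \<alpha>, \<beta> * u $ 1 - (u $ 1)\<^sup>2 * u $ 2]"

definition brusselator_state :: "real \<Rightarrow> real \<Rightarrow> real ^ 2" where
  "brusselator_state \<alpha> \<beta> = vector [\<alpha>, \<beta> / \<alpha>]"

lemma brusselator_state_equilibrium:
  assumes "\<alpha> \<noteq> 0"
  shows "brusselator \<alpha> \<beta> (brusselator_state \<alpha> \<beta>) = 0"
  using assms
  by (simp add: brusselator_def brusselator_state_def vec_eq_iff forall_2 field_simps power2_eq_square)

lemma brusselator_has_derivative:
  assumes "\<alpha> \<noteq> 0"
  shows "(brusselator \<alpha> \<beta> has_derivative
           (\<lambda>h. vector [vector [\<beta> - 1, \<alpha>\<^sup>2], vector [- \<beta>, - (\<alpha>\<^sup>2)]] *v h))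
         (at (brusselator_state \<alpha> \<beta>))"
proof -
  have nth: "((\<lambda>u::real^2. u $ i) has_derivative (\<lambda>h. h $ i)) F" for i F
    by (rule bounded_linear_imp_has_derivative) (rule bounded_linear_vec_nth)
  have "((\<lambda>u. brusselator \<alpha> \<beta> u $ i) has_derivative
          (\<lambda>h. (vector [vector [\<beta> - 1, \<alpha>\<^sup>2], vector [- \<beta>, - (\<alpha>\<^sup>2)]] *v h) $ i))
         (at (brusselator_state \<alpha> \<beta>))" for i
    using exhaust_2[of i] assms
    by (auto simp: brusselator_def brusselator_state_def matrix_vector_mult_def sum_2
          fun_eq_iff power2_eq_square field_simps intro!: derivative_eq_intros nth)
  then show ?thesis
    by (subst has_derivative_componentwise_within)
       (auto simp: Basis_vec_def inner_axis)
qed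

lemma brusselator_linearization:
  assumes "\<alpha> \<noteq> 0"
  shows "kinetic_linearization (brusselator \<alpha> \<beta>) (brusselator_state \<alpha> \<beta>) =
    vector [vector [of_real (\<beta> - 1), of_real (\<alpha>\<^sup>2)], vector [- of_real \<beta>, - of_real (\<alpha>\<^sup>2)]]"
  by (simp add: kinetic_linearization_def jacobian_def vec_eq_iff forall_2
      frechet_derivative_at[OF brusselator_has_derivative[OF assms], symmetric])

end

theory Submission
  imports Defs
begin

text \<open>
  The uniform state is already unstable without diffusion: the linearization of the kinetics has
  trace \<open>\<beta>\<^sub>1 - 1 - \<alpha>\<^sup>2 = \<delta>\<^sub>1 + \<delta>\<^sub>2 > 0\<close> and determinant \<open>\<alpha>\<^sup>2\<close>, and a real quadratic
  \<open>z\<^sup>2 - t z + d\<close> with \<open>t > 0\<close> has a root in the open right half-plane.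
\<close>

lemma quadratic_root_Re_pos:
  fixes t d :: real
  assumes "t > 0"
  obtains z :: complex where "Re z > 0" and "z\<^sup>2 - of_real t * z + of_real d = 0"
proof
  \<comment> \<open>The principal square root has nonnegative real part, so the root with the plus
    sign has real part at least \<open>t / 2\<close>, whatever the sign of the discriminant.\<close>
  let ?s = "csqrt (of_real (t\<^sup>2 - 4 * d))"
  let ?z = "(of_real t + ?s) / 2"
  show "Re ?z > 0"
  proof -
    have "Re ?s \<ge> 0"
      using csqrt_principal[of "of_real (t\<^sup>2 - 4 * d)"] by linarith
    with assms show ?thesis
      by (simp del: csqrt.simps of_real_diff)
  qed
  have "?z\<^sup>2 - of_real t * ?z + of_real d = (?s\<^sup>2 - of_real (t\<^sup>2 - 4 * d)) / 4"
    by (simp add: field_simps power2_eq_square del: power2_csqrt)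
  then show "?z\<^sup>2 - of_real t * ?z + of_real d = 0"
    by (simp only: power2_csqrt) simp
qed

text \<open>Singularity means vanishing determinant, and this is the characteristic
  polynomial.\<close>

lemma matrix_spectrum_2:
  "z \<in> matrix_spectrum (A :: complex ^ 2 ^ 2) \<longleftrightarrow> z\<^sup>2 - trace A * z + det A = 0"
proof -
  have "det (mat z - A) = z\<^sup>2 - trace A * z + det A"
    by (simp add: det_2 trace_def sum_2 mat_def algebra_simps power2_eq_square)
  then show ?thesis
    by (simp add: matrix_spectrum_def invertible_det_nz)
qed

theorem proposition2p1:
  fixes \<alpha> \<delta>\<^sub>1 \<delta>\<^sub>2 \<beta>\<^sub>1 :: real
  assumes "\<alpha> > 0" and "\<delta>\<^sub>1 > 0" and "\<delta>\<^sub>2 > 0"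
    and "\<beta>\<^sub>1 = 1 + \<alpha>\<^sup>2 + \<delta>\<^sub>1 + \<delta>\<^sub>2"
  shows "\<not> Turing_unstable (vector [\<delta>\<^sub>1, \<delta>\<^sub>2]) (brusselator \<alpha> \<beta>\<^sub>1) (brusselator_state \<alpha> \<beta>\<^sub>1)"
proof -
  let ?A = "kinetic_linearization (brusselator \<alpha> \<beta>\<^sub>1) (brusselator_state \<alpha> \<beta>\<^sub>1)"
  have A: "?A = vector [vector [of_real (\<beta>\<^sub>1 - 1), of_real (\<alpha>\<^sup>2)],
                        vector [- of_real \<beta>\<^sub>1, - of_real (\<alpha>\<^sup>2)]]"
    using assms(1) by (intro brusselator_linearization) simp
  have tr: "trace ?A = of_real (\<delta>\<^sub>1 + \<delta>\<^sub>2)"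
    unfolding A by (simp add: trace_def sum_2 assms(4))
  have det: "det ?A = of_real (\<alpha>\<^sup>2)"
    unfolding A by (simp add: det_2 algebra_simps)
  obtain z :: complex where "Re z > 0" and "z\<^sup>2 - of_real (\<delta>\<^sub>1 + \<delta>\<^sub>2) * z + of_real (\<alpha>\<^sup>2) = 0"
    using quadratic_root_Re_pos[of "\<delta>\<^sub>1 + \<delta>\<^sub>2" "\<alpha>\<^sup>2"] assms by auto
  then have "z \<in> matrix_spectrum ?A" and "Re z > 0"
    by (simp_all only: matrix_spectrum_2 tr det)
  \<comment> \<open>The eigenvalue \<open>z\<close> refutes stability without diffusion, the first
    conjunct of \<open>Turing_unstable\<close>.\<close>
  then show ?thesis
    by (auto simp: Turing_unstable_def spectrally_stable_def)
qed

end
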